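(* Assume the Continuum Hypothesis. For each integer $r>1$ there is an almost disjoint family $\mathcal{A}$ on $\omega$ such that $K(\mathcal{A})$ is $r$-Ramsey but not $(r+1)$-Ramsey.
   Context: For a set $S$ and a positive integer $r$, $[S]^r$ denotes the set of all $r$-element subsets of $S$. For an infinite set $S\subseteq\omega$ and a topological space $X$, a function $f\colon[S]^r\to X$ converges to $p\in X$ if for every neighborhood $U$ of $p$ there is a finite set $F$ such that $f(s)\in U$ for all $s\in[S\setminus F]^r$; it is convergent if it converges to some $p\in X$. A space $X$ is $r$-Ramsey (has the $r$-Ramsey property) if for every function $f\colon[\omega]^r\to X$ there is an infinite set $B\subseteq\omega$ such that $f\restriction[B]^r$ is convergent. An almost disjoint family on a countable set $I$ is a family of infinite subsets of $I$ any two distinct members of which have finite intersection. For such a family $\mathcal{A}$, the space $\Psi(\mathcal{A})$ has underlying set $I\cup\{p_A: A\in\mathcal{A}\}$ (with the $p_A$ distinct new points), the points of $I$ are isolated, and basic neighborhoods of $p_A$ are the sets $\{p_A\}\cup(A\setminus F)$ with $F\subseteq A$ finite. The Alexandrov–Urysohn compactum $K(\mathcal{A})=\Psi(\mathcal{A})\cup\{\infty\}$ is the one-point compactification of $\Psi(\mathcal{A})$: neighborhoods of $\infty$ are the sets containing $\infty$ together with the complement of a compact subset of $\Psi(\mathcal{A})$. *)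

theory Defs
  imports "HOL-Analysis.Analysis" "HOL-Library.Ramsey" "HOL-Library.Equipollence"
begin

definition continuum_hypothesis :: bool where
  "continuum_hypothesis \<longleftrightarrow> (\<forall>S::real set. countable S \<or> S \<approx> (UNIV :: real set))"

definition nsets_converges_to ::
    "'b topology \<Rightarrow> nat \<Rightarrow> nat set \<Rightarrow> (nat set \<Rightarrow> 'b) \<Rightarrow> 'b \<Rightarrow> bool" where
  "nsets_converges_to X r S f p \<longleftrightarrow>
     p \<in> topspace X \<and>
     (\<forall>U. openin X U \<and> p \<in> U \<longrightarrow> (\<exists>F. finite F \<and> (\<forall>s \<in> [S - F]\<^bsup>r\<^esup>. f s \<in> U)))"

definition Ramsey_space :: "nat \<Rightarrow> 'b topology \<Rightarrow> bool" where
  "Ramsey_space r X \<longleftrightarrow>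
     (\<forall>f \<in> [UNIV :: nat set]\<^bsup>r\<^esup> \<rightarrow> topspace X.
        \<exists>B. infinite B \<and> (\<exists>p. nsets_converges_to X r B f p))"

definition almost_disjoint_family :: "'a set \<Rightarrow> 'a set set \<Rightarrow> bool" where
  "almost_disjoint_family I \<A> \<longleftrightarrow>
     countable I \<and>
     (\<forall>A \<in> \<A>. A \<subseteq> I \<and> infinite A) \<and>
     (\<forall>A \<in> \<A>. \<forall>B \<in> \<A>. A \<noteq> B \<longrightarrow> finite (A \<inter> B))"

text \<open>The isolated point \<open>x \<in> I\<close> is \<open>Inl x\<close>, and the point \<open>p\<^sub>A\<close> is \<open>Inr A\<close>.\<close>

definition Psi_points :: "'a set \<Rightarrow> 'a set set \<Rightarrow> ('a + 'a set) set" where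
  "Psi_points I \<A> = Inl ` I \<union> Inr ` \<A>"

definition Psi_open :: "'a set \<Rightarrow> 'a set set \<Rightarrow> ('a + 'a set) set \<Rightarrow> bool" where
  "Psi_open I \<A> U \<longleftrightarrow>
     U \<subseteq> Psi_points I \<A> \<and>
     (\<forall>A \<in> \<A>. Inr A \<in> U \<longrightarrow>
        (\<exists>F. finite F \<and> F \<subseteq> A \<and> insert (Inr A) (Inl ` (A - F)) \<subseteq> U))"

definition Psi_space :: "'a set \<Rightarrow> 'a set set \<Rightarrow> ('a + 'a set) topology" where
  "Psi_space I \<A> = topology (Psi_open I \<A>)"

text \<open>The point at infinity is \<open>None\<close>; the points of the \<open>\<Psi>\<close>-space are tagged by \<open>Some\<close>.
  The library takes the complements of closed compact sets as neighbourhoods of \<open>None\<close>; for an almost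
  disjoint family the \<open>\<Psi>\<close>-space is Hausdorff, so its compact sets are closed.\<close>

definition AU_compactum :: "'a set \<Rightarrow> 'a set set \<Rightarrow> ('a + 'a set) option topology" where
  "AU_compactum I \<A> = Alexandroff_compactification (Psi_space I \<A>)"

lemma istopology_Psi_open: "istopology (Psi_open I \<A>)"
  unfolding istopology_def
proof (intro conjI allI impI)
  fix S T assume S: "Psi_open I \<A> S" and T: "Psi_open I \<A> T"
  show "Psi_open I \<A> (S \<inter> T)"
    unfolding Psi_open_def
  proof (intro conjI ballI impI)
    show "S \<inter> T \<subseteq> Psi_points I \<A>"
      using S by (auto simp: Psi_open_def)
    fix A assume A: "A \<in> \<A>" "Inr A \<in> S \<inter> T"
    obtain F where F: "finite F" "F \<subseteq> A" "insert (Inr A) (Inl ` (A - F)) \<subseteq> S"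
      using S A unfolding Psi_open_def by blast
    obtain G where G: "finite G" "G \<subseteq> A" "insert (Inr A) (Inl ` (A - G)) \<subseteq> T"
      using T A unfolding Psi_open_def by blast
    show "\<exists>F. finite F \<and> F \<subseteq> A \<and> insert (Inr A) (Inl ` (A - F)) \<subseteq> S \<inter> T"
      using F G by (intro exI[of _ "F \<union> G"]) auto
  qed
next
  fix \<K> assume K: "\<forall>K\<in>\<K>. Psi_open I \<A> K"
  show "Psi_open I \<A> (\<Union>\<K>)"
    unfolding Psi_open_def
  proof (intro conjI ballI impI)
    show "\<Union>\<K> \<subseteq> Psi_points I \<A>"
      using K by (auto simp: Psi_open_def)
    fix A assume A: "A \<in> \<A>" "Inr A \<in> \<Union>\<K>"
    then obtain K where K': "K \<in> \<K>" "Inr A \<in> K" by blast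
    have "Psi_open I \<A> K"
      using K K'(1) by (rule bspec)
    then obtain F where F: "finite F" "F \<subseteq> A" "insert (Inr A) (Inl ` (A - F)) \<subseteq> K"
      using A(1) K'(2) unfolding Psi_open_def by meson
    have "K \<subseteq> \<Union>\<K>"
      using K'(1) by (rule Union_upper)
    with F(3) have "insert (Inr A) (Inl ` (A - F)) \<subseteq> \<Union>\<K>"
      by (rule subset_trans)
    with F(1,2) show "\<exists>F. finite F \<and> F \<subseteq> A \<and> insert (Inr A) (Inl ` (A - F)) \<subseteq> \<Union>\<K>"
      by (intro exI conjI)
  qed
qed

lemma openin_Psi_space: "openin (Psi_space I \<A>) = Psi_open I \<A>"
  unfolding Psi_space_def by (rule topology_inverse'[OF istopology_Psi_open])

lemma openin_Psi_space_isolated: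
  assumes "x \<in> I"
  shows "openin (Psi_space I \<A>) {Inl x}"
  using assms by (auto simp: openin_Psi_space Psi_open_def Psi_points_def)

lemma openin_Psi_space_basic:
  assumes "almost_disjoint_family I \<A>" "A \<in> \<A>" "finite F" "F \<subseteq> A"
  shows "openin (Psi_space I \<A>) (insert (Inr A) (Inl ` (A - F)))"
  unfolding openin_Psi_space Psi_open_def
proof (intro conjI ballI impI)
  have "A \<subseteq> I"
    using assms(1,2) by (simp add: almost_disjoint_family_def)
  then show "insert (Inr A) (Inl ` (A - F)) \<subseteq> Psi_points I \<A>"
    using assms(2) by (auto simp: Psi_points_def)
  fix B assume "Inr B \<in> insert (Inr A) (Inl ` (A - F))"
  then have "B = A" by auto
  then show "\<exists>G. finite G \<and> G \<subseteq> B \<and> insert (Inr B) (Inl ` (B - G)) \<subseteq> insert (Inr A) (Inl ` (A - F))"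
    using assms(3,4) by blast
qed

lemma topspace_Psi_space:
  assumes "almost_disjoint_family I \<A>"
  shows "topspace (Psi_space I \<A>) = Psi_points I \<A>"
proof
  show "topspace (Psi_space I \<A>) \<subseteq> Psi_points I \<A>"
  proof -
    have "Psi_open I \<A> (topspace (Psi_space I \<A>))"
      using openin_topspace[of "Psi_space I \<A>"] unfolding openin_Psi_space .
    then show ?thesis
      unfolding Psi_open_def by (rule conjunct1)
  qed
  have "Psi_open I \<A> (Psi_points I \<A>)"
    unfolding Psi_open_def
  proof (intro conjI ballI impI)
    fix A assume "A \<in> \<A>" "Inr A \<in> Psi_points I \<A>"
    moreover have "A \<subseteq> I"
      using assms \<open>A \<in> \<A>\<close> by (simp add: almost_disjoint_family_def)
    ultimately show "\<exists>F. finite F \<and> F \<subseteq> A \<and> insert (Inr A) (Inl ` (A - F)) \<subseteq> Psi_points I \<A>"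
      by (intro exI[of _ "{}"]) (auto simp: Psi_points_def)
  qed simp
  then have "openin (Psi_space I \<A>) (Psi_points I \<A>)"
    unfolding openin_Psi_space .
  then show "Psi_points I \<A> \<subseteq> topspace (Psi_space I \<A>)"
    by (rule openin_subset)
qed

end

theory Submission
  imports Defs
begin

text \<open>
  Index the family by the infinite sets \<open>X \<subseteq> \<omega>\<close>, well-ordered so that initial segments are countable,
  and identify \<open>\<omega>\<close> with \<open>[\<omega>]\<^sup>r\<^sup>+\<^sup>1\<close>. Say that \<open>D\<close> separates \<open>a\<close> if every element of \<open>a\<close> lies above an
  element of \<open>D\<close> and any two elements of \<open>a\<close> lie in different intervals cut out by \<open>D\<close>. A diagonal
  choice gives \<open>A\<^sub>X \<subseteq> [X]\<^sup>r\<^sup>+\<^sup>1\<close>, almost disjoint from all earlier \<open>A\<^sub>Y\<close>, such that every earlier \<open>Y\<close>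
  separates almost all members of \<open>A\<^sub>X\<close>. As \<open>A\<^sub>X\<close> lives on \<open>[X]\<^sup>r\<^sup>+\<^sup>1\<close> and each point is in only finitely
  many of its members, the identity on \<open>[\<omega>]\<^sup>r\<^sup>+\<^sup>1\<close> does not converge on any \<open>[X]\<^sup>r\<^sup>+\<^sup>1\<close>.

  Conversely, for \<open>g : [\<omega>]\<^sup>r \<rightarrow> [\<omega>]\<^sup>r\<^sup>+\<^sup>1\<close> Ramsey's theorem yields infinite \<open>B\<close> and \<open>D\<close> such that \<open>D\<close> never
  separates \<open>g s\<close> for \<open>s \<in> [B]\<^sup>r\<close>: the \<open>r\<close> elements of \<open>s\<close> control only \<open>r\<close> intervals of \<open>D\<close>, too few for
  the \<open>r + 1\<close> elements of \<open>g s\<close>. So only countably many \<open>A\<^sub>X\<close> meet the range of \<open>g\<close> on \<open>[B]\<^sup>r\<close> infinitely often,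
  and countably many sets can be handled by Ramsey's theorem alone.
\<close>

section \<open>Infinite Ramsey arguments\<close>

lemma Ramsey_finite_range:
  fixes f :: "'a set \<Rightarrow> 'b"
  assumes "infinite Z" "finite (f ` [Z]\<^bsup>r\<^esup>)"
  obtains H where "H \<subseteq> Z" "infinite H" "\<And>s t. s \<in> [H]\<^bsup>r\<^esup> \<Longrightarrow> t \<in> [H]\<^bsup>r\<^esup> \<Longrightarrow> f s = f t"
proof -
  obtain h :: "'b \<Rightarrow> nat" and n where h: "h ` f ` [Z]\<^bsup>r\<^esup> = {i. i < n}" "inj_on h (f ` [Z]\<^bsup>r\<^esup>)"
    using finite_imp_inj_to_nat_seg[OF assms(2)] by blast
  have "(h \<circ> f) ` [Z]\<^bsup>r\<^esup> \<subseteq> {..<n}"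
    using h(1) by (auto simp: image_comp)
  then obtain H t where H: "H \<subseteq> Z" "infinite H" "(h \<circ> f) ` [H]\<^bsup>r\<^esup> \<subseteq> {t}"
    using Ramsey_nsets[OF assms(1)] by metis
  show thesis
  proof (rule that[OF H(1,2)])
    fix s s' assume s: "s \<in> [H]\<^bsup>r\<^esup>" "s' \<in> [H]\<^bsup>r\<^esup>"
    then have "s \<in> [Z]\<^bsup>r\<^esup>" "s' \<in> [Z]\<^bsup>r\<^esup>"
      using nsets_mono[OF H(1)] by blast+
    moreover have "h (f s) = h (f s')"
      using H(3) s by (auto simp: image_subset_iff)
    ultimately show "f s = f s'"
      using h(2) by (auto dest: inj_onD)
  qed
qed

lemma insert_in_nsets: "s \<in> [H]\<^bsup>r\<^esup> \<Longrightarrow> x \<in> H \<Longrightarrow> x \<notin> s \<Longrightarrow> insert x s \<in> [H]\<^bsup>Suc r\<^esup>"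
  by (auto simp: nsets_def)

lemma remove_in_nsets: "v \<in> [H]\<^bsup>Suc r\<^esup> \<Longrightarrow> x \<in> v \<Longrightarrow> v - {x} \<in> [H]\<^bsup>r\<^esup>"
  by (auto simp: nsets_def)

text \<open>Ranks increase strictly along \<open>v\<close>. This recovers a point from its rank when
  a colour only lists data by rank.\<close>

lemma card_below_inj:
  fixes v :: "'a::linorder set"
  assumes "finite v" "x \<in> v" "y \<in> v" "card ((v - {x}) \<inter> {..<x}) = card ((v - {y}) \<inter> {..<y})"
  shows "x = y"
proof -
  have less: "card ((v - {a}) \<inter> {..<a}) < card ((v - {b}) \<inter> {..<b})" if "a \<in> v" "b \<in> v" "a < b" for a b
    by (rule psubset_card_mono) (use assms(1) that in auto)
  show ?thesis
    using less[OF assms(2,3)] less[OF assms(3,2)] assms(4) by (cases x y rule: linorder_cases) auto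
qed

text \<open>An (r+1)-set \<open>v\<close> encodes all splittings into an r-set \<open>s\<close> and
  an extra point \<open>x\<close>. Colouring \<open>v\<close> by the pairs of counts for all its
  points makes the count of \<open>g s\<close> below \<open>x\<close> depend only on the rank of
  \<open>x\<close> relative to \<open>s\<close>.\<close>

lemma Ramsey_card_below:
  fixes g :: "nat set \<Rightarrow> nat set"
  assumes "infinite Z" and g: "\<And>s. s \<in> [Z]\<^bsup>r\<^esup> \<Longrightarrow> finite (g s) \<and> card (g s) \<le> m"
  obtains H where "H \<subseteq> Z" "infinite H"
    "\<And>s x y. s \<in> [H]\<^bsup>r\<^esup> \<Longrightarrow> x \<in> H - s \<Longrightarrow> y \<in> H - s \<Longrightarrow>
       card (s \<inter> {..<x}) = card (s \<inter> {..<y}) \<Longrightarrow> card (g s \<inter> {..<x}) = card (g s \<inter> {..<y})"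
proof -
  define c where "c v = (\<lambda>x. (card ((v - {x}) \<inter> {..<x}), card (g (v - {x}) \<inter> {..<x}))) ` v" for v
  have "c v \<subseteq> {..r} \<times> {..m}" if v: "v \<in> [Z]\<^bsup>Suc r\<^esup>" for v
  proof -
    have "card ((v - {x}) \<inter> {..<x}) \<le> r \<and> card (g (v - {x}) \<inter> {..<x}) \<le> m" if x: "x \<in> v" for x
    proof
      have "v - {x} \<in> [Z]\<^bsup>r\<^esup>" using remove_in_nsets[OF v x] .
      then have fin: "finite (v - {x})" "card (v - {x}) = r" "finite (g (v - {x}))" "card (g (v - {x})) \<le> m"
        using g by (auto simp: nsets_def)
      show "card ((v - {x}) \<inter> {..<x}) \<le> r" "card (g (v - {x}) \<inter> {..<x}) \<le> m"
        using card_mono[OF fin(1), of "(v - {x}) \<inter> {..<x}"] card_mono[OF fin(3), of "g (v - {x}) \<inter> {..<x}"] fin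
        by auto
    qed
    then show ?thesis by (auto simp: c_def)
  qed
  then have "c ` [Z]\<^bsup>Suc r\<^esup> \<subseteq> Pow ({..r} \<times> {..m})"
    by blast
  then have "finite (c ` [Z]\<^bsup>Suc r\<^esup>)"
    by (rule finite_subset) simp
  then obtain H where H: "H \<subseteq> Z" "infinite H"
      "\<And>v w. v \<in> [H]\<^bsup>Suc r\<^esup> \<Longrightarrow> w \<in> [H]\<^bsup>Suc r\<^esup> \<Longrightarrow> c v = c w"
    using Ramsey_finite_range[OF assms(1)] by metis
  show thesis
  proof (rule that[OF H(1,2)])
    fix s x y assume s: "s \<in> [H]\<^bsup>r\<^esup>" and x: "x \<in> H - s" and y: "y \<in> H - s"
      and eq: "card (s \<inter> {..<x}) = card (s \<inter> {..<y})"
    have rem: "insert x s - {x} = s" "insert y s - {y} = s" using x y by auto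
    have "(card (s \<inter> {..<x}), card (g s \<inter> {..<x})) \<in> c (insert x s)"
      unfolding c_def using rem by (intro image_eqI[of _ _ x]) auto
    also have "c (insert x s) = c (insert y s)"
      by (intro H(3) insert_in_nsets s) (use x y in auto)
    \<comment> \<open>A priori the matching entry in the colour of \<open>insert y s\<close> belongs
      to some other point \<open>z\<close>; its rank forces \<open>z = y\<close>.\<close>
    finally obtain z where "z \<in> insert y s"
        "(card (s \<inter> {..<x}), card (g s \<inter> {..<x})) =
         (card ((insert y s - {z}) \<inter> {..<z}), card (g (insert y s - {z}) \<inter> {..<z}))"
      unfolding c_def by blast
    then have z: "z \<in> insert y s"
        "card (s \<inter> {..<x}) = card ((insert y s - {z}) \<inter> {..<z})"
        "card (g s \<inter> {..<x}) = card (g (insert y s - {z}) \<inter> {..<z})"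
      by (simp_all only: prod.inject)
    have "finite (insert y s)" using s by (simp add: nsets_def)
    moreover have "card ((insert y s - {z}) \<inter> {..<z}) = card ((insert y s - {y}) \<inter> {..<y})"
      using z(2) eq rem(2) by simp
    ultimately have "z = y"
      using card_below_inj z(1) by blast
    then show "card (g s \<inter> {..<x}) = card (g s \<inter> {..<y})"
      using z(3) rem by simp
  qed
qed

section \<open>Sets that a suitable infinite set fails to separate\<close>

definition separates :: "nat set \<Rightarrow> nat set \<Rightarrow> bool" where
  "separates D a \<longleftrightarrow> (\<forall>y\<in>a. \<exists>d\<in>D. d \<le> y) \<and> (\<forall>x\<in>a. \<forall>y\<in>a. x < y \<longrightarrow> (\<exists>d\<in>D. x < d \<and> d \<le> y))"

text \<open>With \<open>B\<close> the odd and \<open>D\<close> the even terms of a homogeneous set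
  \<open>H\<close>, each interval of \<open>D\<close> contains exactly one point of
  \<open>B\<close>. If the r+1 points of \<open>g s\<close> lay in different intervals, one of these
  would have its \<open>B\<close>-point outside \<open>s\<close>. Its endpoints then have equal rank
  relative to \<open>s\<close>, so by homogeneity \<open>g s\<close> has no point in that
  interval.\<close>

lemma Ramsey_not_separates:
  fixes g :: "nat set \<Rightarrow> nat set"
  assumes "infinite Z" and g: "\<And>s. s \<in> [Z]\<^bsup>r\<^esup> \<Longrightarrow> g s \<in> [UNIV]\<^bsup>Suc r\<^esup>"
  obtains B D where "B \<subseteq> Z" "infinite B" "infinite D" "\<And>s. s \<in> [B]\<^bsup>r\<^esup> \<Longrightarrow> \<not> separates D (g s)"
proof -
  have "finite (g s) \<and> card (g s) \<le> Suc r" if "s \<in> [Z]\<^bsup>r\<^esup>" for s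
    using g[OF that] by (auto simp: nsets_def)
  then obtain H where H: "H \<subseteq> Z" "infinite H"
    and hom: "\<And>s x y. s \<in> [H]\<^bsup>r\<^esup> \<Longrightarrow> x \<in> H - s \<Longrightarrow> y \<in> H - s \<Longrightarrow>
       card (s \<inter> {..<x}) = card (s \<inter> {..<y}) \<Longrightarrow> card (g s \<inter> {..<x}) = card (g s \<inter> {..<y})"
    using Ramsey_card_below[OF assms(1), of r g "Suc r"] by (metis (no_types))
  define b where "b = enumerate H"
  have bH: "b i \<in> H" for i
    unfolding b_def by (rule enumerate_in_set[OF H(2)])
  have mono: "strict_mono b"
    unfolding b_def using strict_mono_enumerate[OF H(2)] .
  note less = strict_mono_less[OF mono] and le = strict_mono_less_eq[OF mono] and eq = strict_mono_eq[OF mono]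
  define B where "B = range (\<lambda>i. b (2 * i + 1))"
  define D where "D = range (\<lambda>i. b (2 * i))"
  have "inj (\<lambda>i. b (2 * i + 1))" "inj (\<lambda>i. b (2 * i))"
    by (auto simp: inj_on_def eq)
  then have inf: "infinite B" "infinite D"
    unfolding B_def D_def using range_inj_infinite by blast+
  have "\<not> separates D (g s)" if s: "s \<in> [B]\<^bsup>r\<^esup>" for s
  proof
    assume sep: "separates D (g s)"
    have BH: "B \<subseteq> H" using bH by (auto simp: B_def)
    have sH: "s \<in> [H]\<^bsup>r\<^esup>" using s nsets_mono[OF BH] by blast
    have "g s \<in> [UNIV]\<^bsup>Suc r\<^esup>" using g nsets_mono[OF H(1)] sH by blast
    then have gs: "finite (g s)" "card (g s) = Suc r" by (auto simp: nsets_def)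
    have "\<exists>i. b (2 * i) \<le> y \<and> y < b (2 * i + 2)" if y: "y \<in> g s" for y
    proof -
      obtain j where j: "b (2 * j) \<le> y" using sep y by (auto simp: separates_def D_def)
      \<comment> \<open>\<open>i\<close> numbers the interval of \<open>D\<close> holding
        \<open>y\<close>; for \<open>i = 0\<close> the lower bound rests on the first clause of
        \<open>separates\<close>.\<close>
      define i where "i = (LEAST i. y < b (2 * i + 2))"
      have ex: "y < b (2 * y + 2)" using strict_mono_imp_increasing[OF mono, of "2 * y + 2"] by simp
      then have up: "y < b (2 * i + 2)" unfolding i_def by (rule LeastI)
      have "b (2 * i) \<le> y"
      proof (cases i)
        case 0
        then show ?thesis using j le[of 0 "2 * j"] by auto
      next
        case (Suc k)
        then have "\<not> y < b (2 * k + 2)" unfolding i_def by (metis lessI not_less_Least)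
        then show ?thesis using Suc by simp
      qed
      with up show ?thesis by blast
    qed
    then obtain idx where idx: "\<And>y. y \<in> g s \<Longrightarrow> b (2 * idx y) \<le> y \<and> y < b (2 * idx y + 2)"
      by metis
    have neq: "idx x \<noteq> idx y" if xy: "x \<in> g s" "y \<in> g s" "x < y" for x y
    proof
      assume e: "idx x = idx y"
      obtain j where j: "x < b (2 * j)" "b (2 * j) \<le> y"
        using sep xy unfolding separates_def D_def by blast
      have "b (2 * idx x) < b (2 * j)" "b (2 * j) < b (2 * idx x + 2)"
        using idx[OF xy(1)] idx[OF xy(2)] j e by auto
      then show False by (simp add: less)
    qed
    \<comment> \<open>Pigeonhole: the r+1 points of \<open>g s\<close> give distinct midpoints, so
      the r-set \<open>s\<close> misses one of them.\<close>
    have "inj_on (\<lambda>y. b (2 * idx y + 1)) (g s)"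
      using neq by (intro inj_onI) (metis (no_types) eq add_right_cancel mult_cancel1 nat_neq_iff zero_neq_numeral)
    then have "\<not> (\<lambda>y. b (2 * idx y + 1)) ` g s \<subseteq> s"
      using card_inj_on_le[of _ "g s" s] s gs by (auto simp: nsets_def)
    then obtain y where y: "y \<in> g s" "b (2 * idx y + 1) \<notin> s" by auto
    define i where "i = idx y"
    have notin: "b (2 * k) \<notin> s" for k
    proof
      assume "b (2 * k) \<in> s"
      then obtain j where "b (2 * k) = b (2 * j + 1)" using s by (auto simp: nsets_def B_def)
      then show False unfolding eq by presburger
    qed
    \<comment> \<open>Between the two endpoints \<open>B\<close> has only the midpoint, which is not
      in \<open>s\<close>.\<close>
    have "s \<inter> {..<b (2 * i)} = s \<inter> {..<b (2 * i + 2)}"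
    proof -
      have "z < b (2 * i)" if z: "z \<in> s" "z < b (2 * i + 2)" for z
      proof -
        obtain j where "z = b (2 * j + 1)" using z(1) s by (auto simp: nsets_def B_def)
        moreover from this have "j \<noteq> i" using y(2) z(1) by (auto simp: i_def)
        ultimately show ?thesis using z(2) by (simp add: less)
      qed
      moreover have "b (2 * i) \<le> b (2 * i + 2)" by (simp add: le)
      ultimately show ?thesis by (auto intro: less_le_trans)
    qed
    then have "card (g s \<inter> {..<b (2 * i)}) = card (g s \<inter> {..<b (2 * i + 2)})"
      using notin[of i] notin[of "i + 1"] bH by (intro hom sH) auto
    moreover have "g s \<inter> {..<b (2 * i)} \<subset> g s \<inter> {..<b (2 * i + 2)}"
    proof -
      have "b (2 * i) \<le> b (2 * i + 2)" by (simp add: le)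
      then have "y \<in> g s \<inter> {..<b (2 * i + 2)} - g s \<inter> {..<b (2 * i)}"
          "g s \<inter> {..<b (2 * i)} \<subseteq> g s \<inter> {..<b (2 * i + 2)}"
        using y(1) idx[OF y(1)] by (auto simp: i_def)
      then show ?thesis by blast
    qed
    then have "card (g s \<inter> {..<b (2 * i)}) < card (g s \<inter> {..<b (2 * i + 2)})"
      by (intro psubset_card_mono) auto
    ultimately show False by linarith
  qed
  moreover have "B \<subseteq> Z" using bH H(1) by (auto simp: B_def)
  ultimately show thesis using that inf by blast
qed

text \<open>These are the tails from the definition of convergence: all \<open>s\<close> meeting a
  finite \<open>F\<close> are discarded, so infinitely many exceptions are possible once
  \<open>r > 1\<close>.\<close>

definition eventually_nsets :: "nat set \<Rightarrow> nat \<Rightarrow> (nat set \<Rightarrow> bool) \<Rightarrow> bool" where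
  "eventually_nsets B r P \<longleftrightarrow> (\<exists>F. finite F \<and> (\<forall>s \<in> [B - F]\<^bsup>r\<^esup>. P s))"

lemma eventually_nsets_mono:
  assumes "eventually_nsets B r P" "C \<subseteq> B" "\<And>s. s \<in> [C]\<^bsup>r\<^esup> \<Longrightarrow> P s \<Longrightarrow> Q s"
  shows "eventually_nsets C r Q"
proof -
  obtain F where F: "finite F" "\<forall>s \<in> [B - F]\<^bsup>r\<^esup>. P s"
    using assms(1) unfolding eventually_nsets_def by blast
  have "Q s" if "s \<in> [C - F]\<^bsup>r\<^esup>" for s
    using F(2) assms(2,3) that nsets_mono[of "C - F" "B - F" r] nsets_mono[of "C - F" C r] by blast
  with F(1) show ?thesis unfolding eventually_nsets_def by blast
qed

lemma eventually_nsets_conj: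
  assumes "eventually_nsets B r P" "eventually_nsets B r Q"
  shows "eventually_nsets B r (\<lambda>s. P s \<and> Q s)"
proof -
  obtain F G where FG: "finite F" "\<forall>s \<in> [B - F]\<^bsup>r\<^esup>. P s" "finite G" "\<forall>s \<in> [B - G]\<^bsup>r\<^esup>. Q s"
    using assms unfolding eventually_nsets_def by blast
  have "\<forall>s \<in> [B - (F \<union> G)]\<^bsup>r\<^esup>. P s \<and> Q s"
    using FG nsets_mono[of "B - (F \<union> G)" "B - F" r] nsets_mono[of "B - (F \<union> G)" "B - G" r] by blast
  with FG(1,3) show ?thesis unfolding eventually_nsets_def by (metis finite_UnI)
qed

lemma eventually_nsets_always: "(\<And>s. s \<in> [B]\<^bsup>r\<^esup> \<Longrightarrow> P s) \<Longrightarrow> eventually_nsets B r P"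
  unfolding eventually_nsets_def by (rule exI[of _ "{}"]) auto

lemma eventually_nsets_ball:
  assumes "finite E" "\<And>y. y \<in> E \<Longrightarrow> eventually_nsets B r (P y)"
  shows "eventually_nsets B r (\<lambda>s. \<forall>y\<in>E. P y s)"
  using assms
proof (induction E)
  case empty
  then show ?case by (simp add: eventually_nsets_always)
next
  case (insert y E)
  then have "eventually_nsets B r (\<lambda>s. P y s \<and> (\<forall>y\<in>E. P y s))"
    by (intro eventually_nsets_conj) auto
  then show ?case by simp
qed

text \<open>Number the values and colour an (r+1)-set by whether the value on its upper r points has
  a number below its minimum. If always, the sets above a fixed \<open>x\<close> take finitely many
  values, and Ramsey's theorem makes the value constant. If never, the numbers are at least every
  \<open>x\<close> of \<open>H\<close> below the set, so each fixed value is escaped.\<close>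

lemma Ramsey_constant_or_escaping:
  fixes g :: "nat set \<Rightarrow> 'b"
  assumes "infinite Z" "countable (g ` [Z]\<^bsup>r\<^esup>)"
  obtains H where "H \<subseteq> Z" "infinite H"
    "(\<exists>c. \<forall>s \<in> [H]\<^bsup>r\<^esup>. g s = c) \<or> (\<forall>y. eventually_nsets H r (\<lambda>s. g s \<noteq> y))"
proof -
  define h where "h s = to_nat_on (g ` [Z]\<^bsup>r\<^esup>) (g s)" for s
  have hg: "g s = g t" if "s \<in> [Z]\<^bsup>r\<^esup>" "t \<in> [Z]\<^bsup>r\<^esup>" "h s = h t" for s t
    using that assms(2) unfolding h_def by simp
  define p where "p v \<longleftrightarrow> h (v - {Min v}) < Min v" for v
  have "finite (p ` [Z]\<^bsup>Suc r\<^esup>)"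
    by simp
  then obtain H where H: "H \<subseteq> Z" "infinite H" and
      hom: "\<And>v w. v \<in> [H]\<^bsup>Suc r\<^esup> \<Longrightarrow> w \<in> [H]\<^bsup>Suc r\<^esup> \<Longrightarrow> p v = p w"
    using Ramsey_finite_range[OF assms(1), of p "Suc r"] by metis
  have low: "Min (insert x s) = x \<and> insert x s - {x} = s \<and> insert x s \<in> [H]\<^bsup>Suc r\<^esup> \<and> s \<in> [H]\<^bsup>r\<^esup>"
    if "x \<in> H" "s \<in> [H - {..x}]\<^bsup>r\<^esup>" for x s
  proof -
    have s: "s \<in> [H]\<^bsup>r\<^esup>" using that(2) nsets_mono[of "H - {..x}" H r] by blast
    moreover have "x \<notin> s" using that(2) by (auto simp: nsets_def)
    moreover have "Min (insert x s) = x"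
      using that(2) by (intro Min_eqI) (auto simp: nsets_def)
    ultimately show ?thesis using insert_in_nsets[OF s that(1)] by auto
  qed
  show thesis
  proof (cases "\<exists>v \<in> [H]\<^bsup>Suc r\<^esup>. p v")
    case True
    then have small: "h (v - {Min v}) < Min v" if "v \<in> [H]\<^bsup>Suc r\<^esup>" for v
      using hom that unfolding p_def by blast
    obtain x where x: "x \<in> H" using H(2) by fastforce
    have "h ` [H - {..x}]\<^bsup>r\<^esup> \<subseteq> {..<x}"
      using low[OF x] small by force
    then have "finite (h ` [H - {..x}]\<^bsup>r\<^esup>)" by (rule finite_subset) simp
    moreover have "infinite (H - {..x})" using H(2) by simp
    ultimately obtain H' where H': "H' \<subseteq> H - {..x}" "infinite H'"
      "\<And>s t. s \<in> [H']\<^bsup>r\<^esup> \<Longrightarrow> t \<in> [H']\<^bsup>r\<^esup> \<Longrightarrow> h s = h t"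
      using Ramsey_finite_range[of "H - {..x}" h r] by metis
    have "H' \<subseteq> Z" using H'(1) H(1) by blast
    then have "g s = g t" if "s \<in> [H']\<^bsup>r\<^esup>" "t \<in> [H']\<^bsup>r\<^esup>" for s t
      using hg H'(3) that nsets_mono[of H' Z r] by blast
    then have "\<exists>c. \<forall>s \<in> [H']\<^bsup>r\<^esup>. g s = c" by metis
    then show thesis using that[of H'] \<open>H' \<subseteq> Z\<close> H'(2) by blast
  next
    case False
    have "eventually_nsets H r (\<lambda>s. g s \<noteq> y)" for y
    proof -
      \<comment> \<open>A value numbered below \<open>x\<close> cannot occur above \<open>x\<close>.
        This also covers \<open>y\<close> outside the range, whatever number
        \<open>to_nat_on\<close> gives it.\<close>
      obtain x where x: "x \<in> H" "to_nat_on (g ` [Z]\<^bsup>r\<^esup>) y < x"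
        using H(2) unfolding infinite_nat_iff_unbounded by blast
      have "g s \<noteq> y" if s: "s \<in> [H - {..x}]\<^bsup>r\<^esup>" for s
        using low[OF x(1) s] False x(2) unfolding p_def h_def by force
      then show ?thesis unfolding eventually_nsets_def by (intro exI[of _ "{..x}"]) auto
    qed
    then show thesis using that[of H] H by blast
  qed
qed

section \<open>The almost disjoint family\<close>

text \<open>\<open>R\<close> is the strict part of a well-order of least order type on the power set
  of \<omega>. Its proper initial segments have cardinality below the continuum, hence are countable
  under CH.\<close>

lemma continuum_hypothesis_wellorder:
  assumes continuum_hypothesis
  obtains R :: "nat set rel" where "wf R" "total R" "\<And>X. countable {Y. (Y, X) \<in> R}"
proof
  let ?r = "card_of (UNIV :: nat set set)"
  have wo: "well_order_on UNIV ?r"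
    by (rule card_of_well_order_on)
  show "wf (?r - Id)" using wo by (simp add: well_order_on_def)
  show "total (?r - Id)"
    using wo unfolding well_order_on_def linear_order_on_def total_on_def by (metis DiffI pair_in_Id_conv)
  show "countable {Y. (Y, X) \<in> ?r - Id}" for X
  proof -
    have eq: "{Y. (Y, X) \<in> ?r - Id} = underS ?r X" (is "?S = _") by (auto simp: underS_def)
    have less: "(card_of ?S, ?r) \<in> ordLess"
      unfolding eq by (rule card_of_underS[OF card_of_Card_order]) (simp only: Field_card_of UNIV_I)
    \<comment> \<open>\<open>continuum_hypothesis\<close> speaks of sets of reals, so the segment is
      moved there by \<open>j\<close>.\<close>
    obtain j :: "nat set \<Rightarrow> real" where j: "bij j"
      using nat_sets_eqpoll_reals unfolding eqpoll_def by blast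
    have jS: "?S \<approx> j ` ?S"
      using j by (metis bij_def inj_on_image_eqpoll_self inj_on_subset subset_UNIV eqpoll_sym)
    show ?thesis
    proof (rule ccontr)
      assume "\<not> ?thesis"
      then have "\<not> countable (j ` ?S)"
        using j by (metis bij_def countable_image_inj_on inj_on_subset subset_UNIV)
      then have "j ` ?S \<approx> (UNIV :: real set)"
        using assms unfolding continuum_hypothesis_def by blast
      then have "?S \<approx> (UNIV :: nat set set)"
        by (intro eqpoll_trans[OF jS] eqpoll_trans[OF _ eqpoll_sym[OF nat_sets_eqpoll_reals]])
      then have "(card_of ?S, ?r) \<in> ordIso"
        by (simp add: eqpoll_iff_card_of_ordIso)
      then show False using less not_ordLess_ordIso by blast
    qed
  qed
qed

section \<open>Diagonal choice of separated sets\<close>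

lemma eventually_separates_insert:
  assumes "infinite D" "finite a" "separates D a"
  shows "eventually (\<lambda>x. separates D (insert x a)) sequentially"
proof -
  \<comment> \<open>This \<open>d\<close> lies above all of \<open>a\<close> and cuts off every
    \<open>x\<close> from \<open>d\<close> on. The \<open>0\<close> keeps \<open>Max\<close>
    meaningful when \<open>a\<close> is empty.\<close>
  obtain d where d: "d \<in> D" "Max (insert 0 a) < d"
    using assms(1) unfolding infinite_nat_iff_unbounded by blast
  then have "y < d" if "y \<in> a" for y using that assms(2) by (auto simp: Max_less_iff)
  then have "separates D (insert x a)" if "d \<le> x" for x
    using assms(3) that d(1) unfolding separates_def by fastforce
  then show ?thesis unfolding eventually_sequentially by blast
qed

lemma ex_mem_of_eventually:
  assumes "infinite (X :: nat set)" "eventually P sequentially"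
  obtains x where "x \<in> X" "P x"
  using assms unfolding eventually_sequentially infinite_nat_iff_unbounded_le by blast

text \<open>Points are added one at a time: each of the finitely many requirements admits all
  sufficiently large next points.\<close>

lemma ex_separated:
  assumes "infinite X" "finite \<D>" "\<And>D. D \<in> \<D> \<Longrightarrow> infinite D"
  shows "\<exists>a \<in> [X \<inter> {N..}]\<^bsup>m\<^esup>. \<forall>D\<in>\<D>. separates D a"
proof (induction m)
  case 0
  then show ?case by (simp add: separates_def)
next
  case (Suc m)
  then obtain a where a: "a \<in> [X \<inter> {N..}]\<^bsup>m\<^esup>" "\<forall>D\<in>\<D>. separates D a" by blast
  then have fin: "finite a" by (simp add: nsets_def)
  have "eventually (\<lambda>x. \<forall>D\<in>\<D>. separates D (insert x a)) sequentially"
    using eventually_separates_insert[OF assms(3) fin] a(2) assms(2)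
    by (intro eventually_ball_finite) auto
  moreover have "eventually (\<lambda>x. x \<notin> a) sequentially"
    using fin by (simp add: eventually_cofinite flip: cofinite_eq_sequentially)
  moreover have "eventually (\<lambda>x. x \<ge> N) sequentially" by (rule eventually_ge_at_top)
  ultimately have "eventually (\<lambda>x. (\<forall>D\<in>\<D>. separates D (insert x a)) \<and> x \<notin> a \<and> x \<ge> N) sequentially"
    by (intro eventually_conj)
  then obtain x where "x \<in> X" "(\<forall>D\<in>\<D>. separates D (insert x a)) \<and> x \<notin> a \<and> x \<ge> N"
    using ex_mem_of_eventually[OF assms(1)] by blast
  then show ?case using insert_in_nsets[OF a(1), of x] by blast
qed

text \<open>First choose r separated points and keep the last one free. Every completion of
  \<open>a\<close> contains a fixed \<open>z\<close> in \<open>a\<close>, and \<open>G D\<close> has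
  only finitely many members through \<open>z\<close>, so almost all last points avoid
  \<open>G D\<close>. The point \<open>z\<close> exists because \<open>r > 0\<close>.\<close>

lemma ex_separated_avoiding:
  assumes "infinite X" "finite \<D>" "\<And>D. D \<in> \<D> \<Longrightarrow> infinite D"
    and G: "\<And>D x. D \<in> \<D> \<Longrightarrow> finite {b \<in> G D. x \<in> b}" and "r > 0"
  shows "\<exists>a \<in> [X \<inter> {N..}]\<^bsup>Suc r\<^esup>. \<forall>D\<in>\<D>. separates D a \<and> a \<notin> G D"
proof -
  obtain a where a: "a \<in> [X \<inter> {N..}]\<^bsup>r\<^esup>" "\<forall>D\<in>\<D>. separates D a"
    using ex_separated[of X \<D> N r] assms by blast
  then have fin: "finite a" by (simp add: nsets_def)
  obtain z where z: "z \<in> a" using a(1) assms(5) by (force simp: nsets_def)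
  have "eventually (\<lambda>x. x \<notin> a \<longrightarrow> insert x a \<notin> G D) sequentially" if D: "D \<in> \<D>" for D
  proof -
    have "finite {x. x \<notin> a \<and> insert x a \<in> G D}"
    proof (rule inj_on_finite[OF _ _ G[OF D, of z]])
      show "inj_on (\<lambda>x. insert x a) {x. x \<notin> a \<and> insert x a \<in> G D}"
        by (auto simp: inj_on_def)
    qed (use z in auto)
    then show ?thesis by (simp add: eventually_cofinite flip: cofinite_eq_sequentially)
  qed
  then have "eventually (\<lambda>x. \<forall>D\<in>\<D>. separates D (insert x a) \<and> (x \<notin> a \<longrightarrow> insert x a \<notin> G D)) sequentially"
    using eventually_separates_insert[OF assms(3) fin] a(2) assms(2)
    by (intro eventually_ball_finite ballI eventually_conj) auto
  moreover have "eventually (\<lambda>x. x \<notin> a) sequentially"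
    using fin by (simp add: eventually_cofinite flip: cofinite_eq_sequentially)
  moreover have "eventually (\<lambda>x. x \<ge> N) sequentially" by (rule eventually_ge_at_top)
  ultimately have "eventually (\<lambda>x. (\<forall>D\<in>\<D>. separates D (insert x a) \<and> (x \<notin> a \<longrightarrow> insert x a \<notin> G D))
      \<and> x \<notin> a \<and> x \<ge> N) sequentially"
    by (intro eventually_conj)
  then obtain x where "x \<in> X" "(\<forall>D\<in>\<D>. separates D (insert x a) \<and> (x \<notin> a \<longrightarrow> insert x a \<notin> G D))
      \<and> x \<notin> a \<and> x \<ge> N"
    using ex_mem_of_eventually[OF assms(1)] by blast
  then show ?thesis using insert_in_nsets[OF a(1), of x] by blast
qed

text \<open>Step \<open>n\<close> serves the finitely many \<open>D\<close> numbered at most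
  \<open>n\<close>, so each \<open>D\<close> can fail at finitely many steps only. Choosing inside
  \<open>{n..}\<close> gives both point-finiteness and infinitely many members.\<close>

lemma ex_point_finite_family:
  assumes "infinite X" "countable \<D>" "\<And>D. D \<in> \<D> \<Longrightarrow> infinite D"
    and G: "\<And>D x. D \<in> \<D> \<Longrightarrow> finite {b \<in> G D. x \<in> b}" and "r > 0"
  shows "\<exists>A \<subseteq> [X]\<^bsup>Suc r\<^esup>. infinite A \<and> (\<forall>x. finite {a \<in> A. x \<in> a}) \<and>
           (\<forall>D\<in>\<D>. finite (A \<inter> G D) \<and> finite {a \<in> A. \<not> separates D a})"
proof -
  let ?\<D> = "\<lambda>n. {D \<in> \<D>. to_nat_on \<D> D \<le> n}"
  have "finite (?\<D> n)" for n
    by (rule inj_on_finite[of "to_nat_on \<D>" _ "{..n}"])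
       (auto intro: inj_on_subset[OF inj_on_to_nat_on[OF assms(2)]])
  then have "\<exists>a \<in> [X \<inter> {n..}]\<^bsup>Suc r\<^esup>. \<forall>D\<in>?\<D> n. separates D a \<and> a \<notin> G D" for n
    using assms by (intro ex_separated_avoiding) auto
  then have "\<exists>a. \<forall>n. a n \<in> [X \<inter> {n..}]\<^bsup>Suc r\<^esup> \<and> (\<forall>D\<in>?\<D> n. separates D (a n) \<and> a n \<notin> G D)"
    by (intro choice) blast
  then obtain a where a: "\<And>n. a n \<in> [X \<inter> {n..}]\<^bsup>Suc r\<^esup>"
      "\<And>n D. D \<in> ?\<D> n \<Longrightarrow> separates D (a n) \<and> a n \<notin> G D"
    by blast
  have pf: "finite {b \<in> range a. x \<in> b}" for x
  proof (rule finite_subset)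
    show "{b \<in> range a. x \<in> b} \<subseteq> a ` {..x}"
      using a(1) by (fastforce simp: nsets_def)
  qed simp
  have "infinite (range a)"
  proof
    assume "finite (range a)"
    moreover have "finite (a n)" for n using a(1)[of n] by (auto simp: nsets_def)
    ultimately have "finite (\<Union>(range a))" by auto
    then obtain N where N: "\<Union>(range a) \<subseteq> {..<N}" using finite_nat_iff_bounded by blast
    have "a N \<subseteq> {N..}" "a N \<noteq> {}" using a(1)[of N] by (auto simp: nsets_def)
    then show False using N by fastforce
  qed
  moreover have "finite (range a \<inter> G D) \<and> finite {b \<in> range a. \<not> separates D b}" if D: "D \<in> \<D>" for D
  proof -
    have "separates D (a n) \<and> a n \<notin> G D" if "n \<ge> to_nat_on \<D> D" for n
      using a(2)[of D n] D that by auto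
    then have "range a \<inter> G D \<subseteq> a ` {..<to_nat_on \<D> D}"
        "{b \<in> range a. \<not> separates D b} \<subseteq> a ` {..<to_nat_on \<D> D}"
      using not_le by blast+
    then show ?thesis by (meson finite_imageI finite_lessThan finite_subset)
  qed
  moreover have "range a \<subseteq> [X]\<^bsup>Suc r\<^esup>" using a(1) nsets_mono[of "X \<inter> {_..}" X "Suc r"] by blast
  ultimately show ?thesis using pf by (intro exI[of _ "range a"]) blast
qed

text \<open>This is recursion along \<open>R\<close>: the infinite indices before \<open>X\<close>
  are countably many, and their families, point-finite by induction, play the role of
  \<open>G\<close>.\<close>

lemma ex_separated_family:
  assumes continuum_hypothesis "r > 0"
  obtains A :: "nat set \<Rightarrow> nat set set" where
    "\<And>X. infinite X \<Longrightarrow> A X \<subseteq> [X]\<^bsup>Suc r\<^esup>"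
    "\<And>X. infinite X \<Longrightarrow> infinite (A X)"
    "\<And>X x. infinite X \<Longrightarrow> finite {a \<in> A X. x \<in> a}"
    "\<And>X Y. infinite X \<Longrightarrow> infinite Y \<Longrightarrow> X \<noteq> Y \<Longrightarrow> finite (A X \<inter> A Y)"
    "\<And>D. infinite D \<Longrightarrow> countable {X. infinite X \<and> infinite {a \<in> A X. \<not> separates D a}}"
proof -
  obtain R :: "nat set rel" where R: "wf R" "total R" "\<And>X. countable {Y. (Y, X) \<in> R}"
    using continuum_hypothesis_wellorder[OF assms(1)] by blast
  \<comment> \<open>The predicate is vacuous at finite \<open>X\<close> because the recursion runs
    over all sets of naturals.\<close>
  define P where "P f X A \<longleftrightarrow> (infinite X \<longrightarrow> A \<subseteq> [X]\<^bsup>Suc r\<^esup> \<and> infinite A \<and> (\<forall>x. finite {a \<in> A. x \<in> a}) \<and>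
     (\<forall>D \<in> {Y. (Y, X) \<in> R \<and> infinite Y}. finite (A \<inter> f D) \<and> finite {a \<in> A. \<not> separates D a}))"
    for f :: "nat set \<Rightarrow> nat set set" and X A
  have "\<exists>f. \<forall>X. P f X (f X)"
  proof (rule dependent_wf_choice[OF R(1)])
    show "P f X A = P g X A" if "\<And>Z. (Z, X) \<in> R \<Longrightarrow> f Z = g Z" for f g X A
      using that unfolding P_def by simp
    show "\<exists>A. P f X A" if IH: "\<And>Y. (Y, X) \<in> R \<Longrightarrow> P f Y (f Y)" for f X
    proof (cases "infinite X")
      case True
      have "\<exists>A \<subseteq> [X]\<^bsup>Suc r\<^esup>. infinite A \<and> (\<forall>x. finite {a \<in> A. x \<in> a}) \<and>
         (\<forall>D \<in> {Y. (Y, X) \<in> R \<and> infinite Y}. finite (A \<inter> f D) \<and> finite {a \<in> A. \<not> separates D a})"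
      proof (rule ex_point_finite_family[OF True _ _ _ assms(2)])
        show "countable {Y. (Y, X) \<in> R \<and> infinite Y}"
          by (rule countable_subset[OF _ R(3)[of X]]) auto
      qed (use IH in \<open>auto simp: P_def\<close>)
      then show ?thesis unfolding P_def by blast
    qed (auto simp: P_def)
  qed
  then obtain A where A: "\<And>X. P A X (A X)" by blast
  show thesis
  proof
    show "A X \<subseteq> [X]\<^bsup>Suc r\<^esup>" "infinite (A X)" "finite {a \<in> A X. x \<in> a}" if "infinite X" for X x
      using A[of X] that unfolding P_def by blast+
    show "finite (A X \<inter> A Y)" if XY: "infinite X" "infinite Y" "X \<noteq> Y" for X Y
    proof -
      have "(X, Y) \<in> R \<or> (Y, X) \<in> R" using R(2) XY(3) unfolding total_on_def by blast
      then show ?thesis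
        using A[of X] A[of Y] XY unfolding P_def by (elim disjE) (auto simp: Int_commute)
    qed
    show "countable {X. infinite X \<and> infinite {a \<in> A X. \<not> separates D a}}" if D: "infinite D" for D
    proof (rule countable_subset)
      show "{X. infinite X \<and> infinite {a \<in> A X. \<not> separates D a}} \<subseteq> insert D {Y. (Y, D) \<in> R}"
      proof
        fix X assume X: "X \<in> {X. infinite X \<and> infinite {a \<in> A X. \<not> separates D a}}"
        \<comment> \<open>An index after \<open>D\<close> was chosen with \<open>D\<close> among its
          requirements, so exceptional indices are \<open>D\<close> or its predecessors.\<close>
        then have "(D, X) \<notin> R" using A[of X] D unfolding P_def by blast
        then show "X \<in> insert D {Y. (Y, D) \<in> R}"
          using R(2) unfolding total_on_def by blast
      qed
    qed (use R(3) in auto)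
  qed
qed

section \<open>Convergence in the Alexandroff--Urysohn compactum\<close>

lemma nsets_converges_to_iff_eventually:
  "nsets_converges_to X r B f p \<longleftrightarrow>
     p \<in> topspace X \<and> (\<forall>U. openin X U \<and> p \<in> U \<longrightarrow> eventually_nsets B r (\<lambda>s. f s \<in> U))"
  by (simp add: nsets_converges_to_def eventually_nsets_def)

lemma nsets_converges_to_const:
  assumes "p \<in> topspace X" "\<And>s. s \<in> [B]\<^bsup>r\<^esup> \<Longrightarrow> f s = p"
  shows "nsets_converges_to X r B f p"
  using assms by (auto simp: nsets_converges_to_iff_eventually intro: eventually_nsets_always)

lemma topspace_AU_compactum:
  assumes "almost_disjoint_family I \<A>"
  shows "topspace (AU_compactum I \<A>) = insert None (Some ` (Inl ` I \<union> Inr ` \<A>))"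
  by (simp add: AU_compactum_def topspace_Psi_space[OF assms] Psi_points_def)

text \<open>Cover each point of \<open>C\<close> by its largest basic neighbourhood
  \<open>N z\<close>; the centres of a finite subcover give \<open>E\<close> and
  \<open>\<F>\<close>.\<close>

lemma compactin_Psi_space_subset:
  assumes ad: "almost_disjoint_family I \<A>" and C: "compactin (Psi_space I \<A>) C"
  shows "\<exists>\<F> E. finite \<F> \<and> \<F> \<subseteq> \<A> \<and> finite E \<and> E \<subseteq> I \<and>
    C \<subseteq> Inl ` E \<union> (\<Union>A\<in>\<F>. insert (Inr A) (Inl ` A))"
proof -
  define N where "N z = (case z of Inl x \<Rightarrow> {Inl x} | Inr A \<Rightarrow> insert (Inr A) (Inl ` A))" for z :: "'a + 'a set"
  have sub: "C \<subseteq> Psi_points I \<A>"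
    using compactin_subset_topspace[OF C] by (simp add: topspace_Psi_space[OF ad])
  have "openin (Psi_space I \<A>) (N z)" if "z \<in> C" for z
    using that sub openin_Psi_space_isolated[of _ I \<A>] openin_Psi_space_basic[OF ad, of _ "{}"]
    by (auto simp: N_def Psi_points_def split: sum.split)
  moreover have "C \<subseteq> \<Union>(N ` C)"
    by (force simp: N_def split: sum.splits)
  ultimately obtain \<U> where \<U>: "finite \<U>" "\<U> \<subseteq> N ` C" "C \<subseteq> \<Union>\<U>"
    using C unfolding compactin_def by (metis (no_types, lifting) imageE)
  then obtain Z where Z: "Z \<subseteq> C" "finite Z" "\<U> = N ` Z"
    by (meson finite_subset_image)
  show ?thesis
  proof (intro exI conjI)
    show "finite (Inr -` Z)" "finite (Inl -` Z)"
      using Z(2) by (auto intro: finite_vimageI)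
    show "Inr -` Z \<subseteq> \<A>" "Inl -` Z \<subseteq> I"
      using Z(1) sub by (auto simp: Psi_points_def)
    show "C \<subseteq> Inl ` (Inl -` Z) \<union> (\<Union>A\<in>Inr -` Z. insert (Inr A) (Inl ` A))"
    proof
      fix w assume "w \<in> C"
      then obtain z where z: "z \<in> Z" "w \<in> N z" using \<U>(3) Z(3) by blast
      then show "w \<in> Inl ` (Inl -` Z) \<union> (\<Union>A\<in>Inr -` Z. insert (Inr A) (Inl ` A))"
        by (cases z) (auto simp: N_def)
    qed
  qed
qed

text \<open>A compact set is covered by finitely many isolated points and finitely many members with
  their limit points. Escaping each point and the isolated part of each member therefore
  suffices.\<close>

lemma nsets_converges_to_infinity:
  assumes ad: "almost_disjoint_family I \<A>"
    and f: "\<And>s. s \<in> [B]\<^bsup>r\<^esup> \<Longrightarrow> f s \<in> topspace (AU_compactum I \<A>)"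
    and points: "\<And>z. eventually_nsets B r (\<lambda>s. f s \<noteq> Some z)"
    and sets: "\<And>A. A \<in> \<A> \<Longrightarrow> eventually_nsets B r (\<lambda>s. f s \<notin> Some ` Inl ` A)"
  shows "nsets_converges_to (AU_compactum I \<A>) r B f None"
  unfolding nsets_converges_to_iff_eventually
proof (intro conjI allI impI)
  show "None \<in> topspace (AU_compactum I \<A>)" by (simp add: topspace_AU_compactum[OF ad])
  fix U assume "openin (AU_compactum I \<A>) U \<and> None \<in> U"
  then obtain C where C: "compactin (Psi_space I \<A>) C"
      "U = insert None (Some ` (topspace (Psi_space I \<A>) - C))"
    unfolding AU_compactum_def openin_Alexandroff_compactification by blast
  obtain \<F> E where FE: "finite \<F>" "\<F> \<subseteq> \<A>" "finite E"
      "C \<subseteq> Inl ` E \<union> (\<Union>A\<in>\<F>. insert (Inr A) (Inl ` A))"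
    using compactin_Psi_space_subset[OF ad C(1)] by blast
  have "eventually_nsets B r (\<lambda>s. \<forall>x\<in>E. f s \<noteq> Some (Inl x))"
    by (intro eventually_nsets_ball FE points)
  moreover have "eventually_nsets B r (\<lambda>s. \<forall>A\<in>\<F>. f s \<noteq> Some (Inr A) \<and> f s \<notin> Some ` Inl ` A)"
    using FE(2) by (intro eventually_nsets_ball eventually_nsets_conj FE(1) points sets) auto
  ultimately show "eventually_nsets B r (\<lambda>s. f s \<in> U)"
  proof (rule eventually_nsets_mono[OF eventually_nsets_conj subset_refl])
    fix s assume s: "s \<in> [B]\<^bsup>r\<^esup>" and *: "(\<forall>x\<in>E. f s \<noteq> Some (Inl x)) \<and>
        (\<forall>A\<in>\<F>. f s \<noteq> Some (Inr A) \<and> f s \<notin> Some ` Inl ` A)"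
    show "f s \<in> U"
    proof (cases "f s")
      case (Some z)
      then have "z \<notin> Inl ` E \<union> (\<Union>A\<in>\<F>. insert (Inr A) (Inl ` A))" using * unfolding Some by fastforce
      then have "z \<notin> C" using subsetD[OF FE(4)] by metis
      moreover have "z \<in> topspace (Psi_space I \<A>)" using f[OF s] Some by (auto simp: AU_compactum_def)
      ultimately show ?thesis using Some C(2) by auto
    qed (simp add: C(2))
  qed
qed

text \<open>A neighbourhood of the limit point omits only finitely many points of \<open>A\<close>,
  each of which is escaped.\<close>

lemma nsets_converges_to_limit_point:
  assumes ad: "almost_disjoint_family I \<A>" and A: "A \<in> \<A>"
    and f: "\<And>s. s \<in> [B]\<^bsup>r\<^esup> \<Longrightarrow> f s \<in> Some ` Inl ` A"
    and points: "\<And>z. eventually_nsets B r (\<lambda>s. f s \<noteq> Some z)"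
  shows "nsets_converges_to (AU_compactum I \<A>) r B f (Some (Inr A))"
  unfolding nsets_converges_to_iff_eventually
proof (intro conjI allI impI)
  show "Some (Inr A) \<in> topspace (AU_compactum I \<A>)" using A by (simp add: topspace_AU_compactum[OF ad])
  fix U assume U: "openin (AU_compactum I \<A>) U \<and> Some (Inr A) \<in> U"
  have "openin (Psi_space I \<A>) (Some -` U)"
  proof -
    consider V where "openin (Psi_space I \<A>) V" "U = Some ` V"
      | C where "closedin (Psi_space I \<A>) C" "U = insert None (Some ` (topspace (Psi_space I \<A>) - C))"
      using U unfolding AU_compactum_def openin_Alexandroff_compactification by blast
    then show ?thesis
    proof cases
      case 1
      then show ?thesis by (simp add: inj_vimage_image_eq)
    next
      case 2
      then have "Some -` U = topspace (Psi_space I \<A>) - C" by auto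
      with 2(1) show ?thesis by (simp add: openin_diff)
    qed
  qed
  then obtain F where F: "finite F" "insert (Inr A) (Inl ` (A - F)) \<subseteq> Some -` U"
    using U A unfolding openin_Psi_space Psi_open_def by fastforce
  have "eventually_nsets B r (\<lambda>s. \<forall>x\<in>F. f s \<noteq> Some (Inl x))"
    by (intro eventually_nsets_ball F points)
  then show "eventually_nsets B r (\<lambda>s. f s \<in> U)"
    by (rule eventually_nsets_mono) (use f F(2) in force)+
qed

lemma openin_AU_compactum_isolated:
  "x \<in> I \<Longrightarrow> openin (AU_compactum I \<A>) {Some (Inl x)}"
  unfolding AU_compactum_def openin_Alexandroff_compactification
  by (metis image_empty image_insert openin_Psi_space_isolated)

lemma openin_AU_compactum_limit_point:
  assumes "almost_disjoint_family I \<A>" "A \<in> \<A>"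
  shows "openin (AU_compactum I \<A>) (Some ` insert (Inr A) (Inl ` A))"
  using openin_Psi_space_basic[OF assms, of "{}"]
  unfolding AU_compactum_def openin_Alexandroff_compactification by auto

text \<open>\<open>A\<close> with its limit point is compact, since an open set around the limit
  point leaves only finitely many points of \<open>A\<close> to cover. It is closed, since any other
  member meets \<open>A\<close> in a finite set.\<close>

lemma openin_AU_compactum_compl:
  assumes ad: "almost_disjoint_family I \<A>" and A: "A \<in> \<A>"
  shows "openin (AU_compactum I \<A>) (topspace (AU_compactum I \<A>) - Some ` insert (Inr A) (Inl ` A))"
proof -
  let ?X = "Psi_space I \<A>" and ?C = "insert (Inr A) (Inl ` A)"
  have sub: "?C \<subseteq> topspace ?X"
    using ad A by (auto simp: topspace_Psi_space[OF ad] Psi_points_def almost_disjoint_family_def)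
  have "compactin ?X ?C"
    unfolding compactin_def
  proof (intro conjI sub allI impI)
    fix \<U> assume \<U>: "Ball \<U> (openin ?X) \<and> ?C \<subseteq> \<Union>\<U>"
    then obtain U where U: "U \<in> \<U>" "Inr A \<in> U" by auto
    then obtain F where F: "finite F" "F \<subseteq> A" "insert (Inr A) (Inl ` (A - F)) \<subseteq> U"
      using \<U> A unfolding openin_Psi_space Psi_open_def by fastforce
    have "\<forall>x\<in>F. \<exists>V\<in>\<U>. Inl x \<in> V" using \<U> F(2) by (auto simp: subset_iff)
    then obtain V where V: "\<And>x. x \<in> F \<Longrightarrow> V x \<in> \<U> \<and> Inl x \<in> V x" by metis
    show "\<exists>\<V>. finite \<V> \<and> \<V> \<subseteq> \<U> \<and> ?C \<subseteq> \<Union>\<V>"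
      by (rule exI[of _ "insert U (V ` F)"]) (use U F V in fastforce)
  qed
  moreover have "closedin ?X ?C"
    unfolding closedin_def openin_Psi_space Psi_open_def
  proof (intro conjI sub ballI impI)
    show "topspace ?X - ?C \<subseteq> Psi_points I \<A>" by (auto simp: topspace_Psi_space[OF ad])
    fix B assume B: "B \<in> \<A>" "Inr B \<in> topspace ?X - ?C"
    have "finite (A \<inter> B)" "B \<subseteq> I"
      using ad A B unfolding almost_disjoint_family_def by auto
    then show "\<exists>F. finite F \<and> F \<subseteq> B \<and> insert (Inr B) (Inl ` (B - F)) \<subseteq> topspace ?X - ?C"
      using B by (intro exI[of _ "A \<inter> B"]) (auto simp: topspace_Psi_space[OF ad] Psi_points_def)
  qed
  moreover have "topspace (AU_compactum I \<A>) - Some ` ?C = insert None (Some ` (topspace ?X - ?C))"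
    by (auto simp: AU_compactum_def)
  ultimately show ?thesis
    unfolding AU_compactum_def openin_Alexandroff_compactification by blast
qed

section \<open>Criteria for having and for failing the Ramsey property\<close>

lemma countable_nsets:
  fixes Z :: "'a::countable set"
  shows "countable ([Z]\<^bsup>r\<^esup>)"
  by (rule countable_subset[OF _ countable_Collect_finite]) (auto simp: nsets_def)

lemma ex_nset_of_infinite:
  assumes "infinite B"
  shows "\<exists>s. s \<in> [B]\<^bsup>r\<^esup>"
  using assms nsets_eq_empty_iff[of B r] by auto

text \<open>Limit points either become constant or escape to infinity, so the work lies with
  isolated values. Once these escape every point, they escape each member meeting the range
  finitely; the countably many other members are handled by colouring with their numbers.\<close>

lemma Ramsey_space_AU_compactumI:
  assumes ad: "almost_disjoint_family I \<A>"
    and isolated: "\<And>g (Z :: nat set). infinite Z \<Longrightarrow> g \<in> [Z]\<^bsup>r\<^esup> \<rightarrow> I \<Longrightarrow>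
      \<exists>B \<subseteq> Z. infinite B \<and> countable {A \<in> \<A>. infinite (A \<inter> g ` [B]\<^bsup>r\<^esup>)}"
  shows "Ramsey_space r (AU_compactum I \<A>)"
  unfolding Ramsey_space_def
proof
  let ?X = "AU_compactum I \<A>"
  fix f :: "nat set \<Rightarrow> ('a + 'a set) option"
  assume f: "f \<in> [UNIV]\<^bsup>r\<^esup> \<rightarrow> topspace ?X"
  \<comment> \<open>Homogeneity for this colour makes all values infinity, all isolated or all limit
    points.\<close>
  define kind :: "('a + 'a set) option \<Rightarrow> nat" where
    "kind z = (case z of None \<Rightarrow> 0 | Some (Inl x) \<Rightarrow> 1 | Some (Inr A) \<Rightarrow> 2)" for z
  have "finite ((kind \<circ> f) ` [UNIV]\<^bsup>r\<^esup>)"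
    by (rule finite_subset[of _ "{0, 1, 2}"]) (auto simp: kind_def split: option.splits sum.splits)
  then obtain Z :: "nat set" where Z: "infinite Z"
      "\<And>s t. s \<in> [Z]\<^bsup>r\<^esup> \<Longrightarrow> t \<in> [Z]\<^bsup>r\<^esup> \<Longrightarrow> (kind \<circ> f) s = (kind \<circ> f) t"
    using Ramsey_finite_range[of "UNIV :: nat set" "kind \<circ> f" r] infinite_UNIV_nat by metis
  have top: "f s \<in> topspace ?X" if "s \<in> [B]\<^bsup>r\<^esup>" for s B
    using f nsets_mono[of B UNIV r] that by auto
  obtain s0 where s0: "s0 \<in> [Z]\<^bsup>r\<^esup>" using ex_nset_of_infinite[OF Z(1)] by blast
  have kind: "kind (f s) = kind (f s0)" if "s \<in> [Z]\<^bsup>r\<^esup>" for s using Z(2)[OF that s0] by simp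
  have const: "\<exists>B. infinite B \<and> (\<exists>p. nsets_converges_to ?X r B f p)"
    if B: "infinite B" "\<forall>s \<in> [B]\<^bsup>r\<^esup>. f s = c" for B c
  proof -
    obtain s where s: "s \<in> [B]\<^bsup>r\<^esup>"
      using ex_nset_of_infinite[OF B(1)] by blast
    then have "c \<in> topspace ?X" using top[OF s] B(2) by auto
    then show ?thesis using nsets_converges_to_const[of c ?X B r f] B by blast
  qed
  consider "f s0 = None" | x where "f s0 = Some (Inl x)" | A where "f s0 = Some (Inr A)"
    by (metis option.exhaust sum.exhaust)
  then show "\<exists>B. infinite B \<and> (\<exists>p. nsets_converges_to ?X r B f p)"
  proof cases
    case 1
    then have "f s = None" if "s \<in> [Z]\<^bsup>r\<^esup>" for s
      using kind[OF that] by (auto simp: kind_def split: option.splits sum.splits)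
    then show ?thesis using const Z(1) by blast
  next
    case (3 A0)
    then have Inr: "\<exists>A. f s = Some (Inr A)" if "s \<in> [Z]\<^bsup>r\<^esup>" for s
      using kind[OF that] by (auto simp: kind_def split: option.splits sum.splits)
    have "countable (f ` [Z]\<^bsup>r\<^esup>)"
      by (simp add: countable_nsets)
    then obtain H where H: "H \<subseteq> Z" "infinite H"
        "(\<exists>c. \<forall>s \<in> [H]\<^bsup>r\<^esup>. f s = c) \<or> (\<forall>y. eventually_nsets H r (\<lambda>s. f s \<noteq> y))"
      using Ramsey_constant_or_escaping[OF Z(1)] by metis
    from H(3) show ?thesis
    proof
      assume esc: "\<forall>y. eventually_nsets H r (\<lambda>s. f s \<noteq> y)"
      have "nsets_converges_to ?X r H f None"
      proof (rule nsets_converges_to_infinity[OF ad top])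
        show "eventually_nsets H r (\<lambda>s. f s \<notin> Some ` Inl ` A)" for A
        proof (rule eventually_nsets_always)
          fix s assume "s \<in> [H]\<^bsup>r\<^esup>"
          then show "f s \<notin> Some ` Inl ` A" using Inr[of s] nsets_mono[OF H(1), of r] by auto
        qed
      qed (use esc in auto)
      then show ?thesis using H(2) by blast
    qed (use const H(2) in blast)
  next
    case (2 x0)
    then have Inl: "\<exists>x. f s = Some (Inl x)" if "s \<in> [Z]\<^bsup>r\<^esup>" for s
      using kind[OF that] by (auto simp: kind_def split: option.splits sum.splits)
    then obtain g where g: "\<And>s. s \<in> [Z]\<^bsup>r\<^esup> \<Longrightarrow> f s = Some (Inl (g s))" by metis
    have gI: "g \<in> [Z]\<^bsup>r\<^esup> \<rightarrow> I"
      using top[of _ Z] g by (auto simp: topspace_AU_compactum[OF ad])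
    obtain B where B: "B \<subseteq> Z" "infinite B" "countable {A \<in> \<A>. infinite (A \<inter> g ` [B]\<^bsup>r\<^esup>)}"
      using isolated[OF Z(1) gI] by blast
    define \<C> where "\<C> = {A \<in> \<A>. infinite (A \<inter> g ` [B]\<^bsup>r\<^esup>)}"
    have "countable (g ` [B]\<^bsup>r\<^esup>)"
    proof (rule countable_subset)
      show "g ` [B]\<^bsup>r\<^esup> \<subseteq> I" using gI nsets_mono[OF B(1), of r] by auto
      show "countable I" using ad by (simp add: almost_disjoint_family_def)
    qed
    then obtain H where H: "H \<subseteq> B" "infinite H"
        "(\<exists>c. \<forall>s \<in> [H]\<^bsup>r\<^esup>. g s = c) \<or> (\<forall>y. eventually_nsets H r (\<lambda>s. g s \<noteq> y))"
      using Ramsey_constant_or_escaping[OF B(2)] by metis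
    have gH: "f s = Some (Inl (g s))" if "s \<in> [H]\<^bsup>r\<^esup>" for s
      using g nsets_mono[of H Z r] B(1) H(1) that by blast
    from H(3) show ?thesis
    proof
      assume "\<exists>c. \<forall>s \<in> [H]\<^bsup>r\<^esup>. g s = c"
      then show ?thesis using const H(2) gH by metis
    next
      assume esc: "\<forall>y. eventually_nsets H r (\<lambda>s. g s \<noteq> y)"
      have points: "eventually_nsets H' r (\<lambda>s. f s \<noteq> Some z)" if "H' \<subseteq> H" for z H'
      proof (cases z)
        case (Inl y)
        show ?thesis
          by (rule eventually_nsets_mono[OF esc[rule_format, of y] that])
            (use Inl gH nsets_mono[OF that, of r] in auto)
      next
        case (Inr A)
        then show ?thesis using gH nsets_mono[OF that, of r] by (intro eventually_nsets_always) auto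
      qed
      \<comment> \<open>If \<open>m\<close> is constant on \<open>[K]\<^sup>r\<close>, then \<open>g\<close> lies in one member of \<open>\<C>\<close> or in none;
        if \<open>m\<close> escapes, then \<open>g\<close> escapes from every member.\<close>
      define m where "m s = (if \<exists>A\<in>\<C>. g s \<in> A
          then Some (LEAST n. \<exists>A\<in>\<C>. g s \<in> A \<and> to_nat_on \<C> A = n) else None)" for s
      have "countable (m ` [H]\<^bsup>r\<^esup>)" by simp
      then obtain K where K: "K \<subseteq> H" "infinite K"
          "(\<exists>c. \<forall>s \<in> [K]\<^bsup>r\<^esup>. m s = c) \<or> (\<forall>y. eventually_nsets K r (\<lambda>s. m s \<noteq> y))"
        using Ramsey_constant_or_escaping[OF H(2)] by metis
      \<comment> \<open>The least number is used so that \<open>g s\<close> in \<open>A\<close>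
        bounds \<open>m s\<close> by the number of \<open>A\<close>, even if other members contain
        \<open>g s\<close>.\<close>
      have m: "\<exists>n \<le> to_nat_on \<C> A. m s = Some n" if "A \<in> \<C>" "g s \<in> A" for A s
        using that by (auto simp: m_def intro!: Least_le)
      have infinity: ?thesis if out: "\<And>A. A \<in> \<C> \<Longrightarrow> eventually_nsets K r (\<lambda>s. g s \<notin> A)"
      proof -
        have "nsets_converges_to ?X r K f None"
        proof (rule nsets_converges_to_infinity[OF ad top points[OF K(1)]])
          fix A assume A: "A \<in> \<A>"
          have "eventually_nsets K r (\<lambda>s. g s \<notin> A)"
          proof (cases "A \<in> \<C>")
            case False
            \<comment> \<open>A member outside \<open>\<C>\<close> meets the range in a finite set,
              whose points are escaped one by one.\<close>
            then have fin: "finite (A \<inter> g ` [B]\<^bsup>r\<^esup>)" using A by (simp add: \<C>_def)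
            have "eventually_nsets K r (\<lambda>s. \<forall>x\<in>A \<inter> g ` [B]\<^bsup>r\<^esup>. g s \<noteq> x)"
              by (intro eventually_nsets_ball[OF fin] eventually_nsets_mono[OF esc[rule_format] K(1)])
            then show ?thesis
              by (rule eventually_nsets_mono) (use H(1) K(1) nsets_mono[of K B r] in auto)
          qed (rule out)
          then show "eventually_nsets K r (\<lambda>s. f s \<notin> Some ` Inl ` A)"
            by (rule eventually_nsets_mono) (use gH nsets_mono[OF K(1), of r] in auto)
        qed
        then show ?thesis using K(2) by blast
      qed
      from K(3) show ?thesis
      proof
        assume "\<forall>y. eventually_nsets K r (\<lambda>s. m s \<noteq> y)"
        then have esc_m: "eventually_nsets K r (\<lambda>s. \<forall>n\<in>{..N}. m s \<noteq> Some n)" for N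
          by (intro eventually_nsets_ball) auto
        show ?thesis
        proof (rule infinity)
          fix A assume A: "A \<in> \<C>"
          show "eventually_nsets K r (\<lambda>s. g s \<notin> A)"
            by (rule eventually_nsets_mono[OF esc_m[of "to_nat_on \<C> A"]]) (use m[OF A] in auto)
        qed
      next
        assume "\<exists>c. \<forall>s \<in> [K]\<^bsup>r\<^esup>. m s = c"
        then obtain c where c: "\<And>s. s \<in> [K]\<^bsup>r\<^esup> \<Longrightarrow> m s = c" by blast
        show ?thesis
        proof (cases c)
          case None
          show ?thesis
          proof (rule infinity)
            fix A assume A: "A \<in> \<C>"
            show "eventually_nsets K r (\<lambda>s. g s \<notin> A)"
              by (rule eventually_nsets_always) (use m[OF A] c None in fastforce)
          qed
        next
          case (Some n)
          have ex: "\<exists>A\<in>\<C>. g s \<in> A \<and> to_nat_on \<C> A = n" if "s \<in> [K]\<^bsup>r\<^esup>" for s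
          proof -
            have *: "\<exists>A\<in>\<C>. g s \<in> A" "n = (LEAST n. \<exists>A\<in>\<C>. g s \<in> A \<and> to_nat_on \<C> A = n)"
              using c[OF that] Some by (auto simp: m_def split: if_splits)
            then have "\<exists>n. \<exists>A\<in>\<C>. g s \<in> A \<and> to_nat_on \<C> A = n" by blast
            from LeastI_ex[OF this] show ?thesis using *(2) by simp
          qed
          obtain s1 where s1: "s1 \<in> [K]\<^bsup>r\<^esup>" using ex_nset_of_infinite[OF K(2)] by blast
          obtain A where A: "A \<in> \<C>" "to_nat_on \<C> A = n" using ex[OF s1] by blast
          have inA: "g s \<in> A" if s: "s \<in> [K]\<^bsup>r\<^esup>" for s
          proof -
            obtain A' where A': "A' \<in> \<C>" "g s \<in> A'" "to_nat_on \<C> A' = n" using ex[OF s] by blast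
            \<comment> \<open>The constant number \<open>n\<close> determines the member, as the
              numbering is injective on the countable \<open>\<C>\<close>.\<close>
            have "A' = A"
              using B(3) A A' to_nat_on_inj[of \<C>] unfolding \<C>_def[symmetric] by blast
            with A' show ?thesis by simp
          qed
          have "A \<in> \<A>" using A by (simp add: \<C>_def)
          moreover have "f s \<in> Some ` Inl ` A" if "s \<in> [K]\<^bsup>r\<^esup>" for s
            using inA[OF that] gH nsets_mono[OF K(1), of r] that by auto
          ultimately show ?thesis
            using nsets_converges_to_limit_point[OF ad _ _ points[OF K(1)]] K(2) by blast
        qed
      qed
    qed
  qed
qed

text \<open>The map \<open>c\<close> into the isolated points converges on no infinite
  \<open>B\<close>. The limit is not infinity: discarding the sets that meet a finite
  \<open>F\<close> removes only finitely many points of the member given by \<open>hit\<close>. It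
  is no isolated point by injectivity, and no limit point by point-finiteness, because infinitely
  many k-sets of a tail share a point.\<close>

lemma not_Ramsey_space_AU_compactum:
  fixes c :: "nat set \<Rightarrow> 'a"
  assumes ad: "almost_disjoint_family I \<A>"
    and c: "inj_on c ([UNIV]\<^bsup>k\<^esup>)" "c ` [UNIV]\<^bsup>k\<^esup> \<subseteq> I"
    and hit: "\<And>B. infinite B \<Longrightarrow> \<exists>A\<in>\<A>. infinite (A \<inter> c ` [B]\<^bsup>k\<^esup>)"
    and point_finite: "\<And>A x. A \<in> \<A> \<Longrightarrow> finite {a \<in> [UNIV]\<^bsup>k\<^esup>. c a \<in> A \<and> x \<in> a}"
    and "k > 1"
  shows "\<not> Ramsey_space k (AU_compactum I \<A>)"
proof
  let ?X = "AU_compactum I \<A>"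
  define f :: "nat set \<Rightarrow> ('a + 'a set) option" where "f s = Some (Inl (c s))" for s
  assume "Ramsey_space k ?X"
  moreover have "f \<in> [UNIV]\<^bsup>k\<^esup> \<rightarrow> topspace ?X"
    using c(2) by (auto simp: f_def topspace_AU_compactum[OF ad])
  ultimately obtain B p where B: "infinite B" "nsets_converges_to ?X k B f p"
    unfolding Ramsey_space_def by blast
  have p: "p \<in> topspace ?X"
    and conv: "\<And>U. openin ?X U \<Longrightarrow> p \<in> U \<Longrightarrow> \<exists>F. finite F \<and> (\<forall>s \<in> [B - F]\<^bsup>k\<^esup>. f s \<in> U)"
    using B(2) unfolding nsets_converges_to_def by blast+
  \<comment> \<open>Here \<open>k > 1\<close> enters: \<open>x\<close> can be joined with any other
    \<open>y\<close> and \<open>k - 2\<close> further points.\<close>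
  have many: "infinite {s \<in> [B - F]\<^bsup>k\<^esup>. x \<in> s}" if F: "finite F" and x: "x \<in> B - F" for F x
  proof
    assume "finite {s \<in> [B - F]\<^bsup>k\<^esup>. x \<in> s}"
    then have fin: "finite (\<Union>{s \<in> [B - F]\<^bsup>k\<^esup>. x \<in> s})" by (auto simp: nsets_def)
    have "B - F - {x} \<subseteq> \<Union>{s \<in> [B - F]\<^bsup>k\<^esup>. x \<in> s}"
    proof
      fix y assume y: "y \<in> B - F - {x}"
      have "infinite (B - F - {x, y})" using B(1) F by simp
      then obtain t where t: "t \<in> nsets (B - F - {x, y}) (k - 2)"
        using ex_nset_of_infinite by blast
      then have "t \<in> nsets (B - F) (k - 2)" "x \<notin> insert y t" "y \<notin> t"
        using y by (auto simp: nsets_def)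
      then have "insert x (insert y t) \<in> nsets (B - F) (Suc (Suc (k - 2)))"
        using x y by (intro insert_in_nsets) auto
      moreover have "Suc (Suc (k - 2)) = k" using \<open>k > 1\<close> by simp
      ultimately have "insert x (insert y t) \<in> [B - F]\<^bsup>k\<^esup>" by simp
      then show "y \<in> \<Union>{s \<in> [B - F]\<^bsup>k\<^esup>. x \<in> s}" by blast
    qed
    then have "finite (B - F - {x})" using fin finite_subset by blast
    then show False using B(1) F by simp
  qed
  have ex: "\<exists>x. x \<in> B - F" if "finite F" for F
    using B(1) that by (metis Diff_infinite_finite ex_in_conv finite.emptyI)
  consider "p = None" | y where "p = Some (Inl y)" "y \<in> I" | A where "p = Some (Inr A)" "A \<in> \<A>"
    using p by (auto simp: topspace_AU_compactum[OF ad])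
  then show False
  proof cases
    case 1
    obtain A where A: "A \<in> \<A>" "infinite (A \<inter> c ` [B]\<^bsup>k\<^esup>)" using hit[OF B(1)] by blast
    obtain F where F: "finite F" "\<forall>s \<in> [B - F]\<^bsup>k\<^esup>. f s \<in> topspace ?X - Some ` insert (Inr A) (Inl ` A)"
      using conv[OF openin_AU_compactum_compl[OF ad A(1)]] p 1 by auto
    have "A \<inter> c ` [B]\<^bsup>k\<^esup> \<subseteq> c ` (\<Union>x\<in>F. {a \<in> [UNIV]\<^bsup>k\<^esup>. c a \<in> A \<and> x \<in> a})"
    proof
      fix y assume "y \<in> A \<inter> c ` [B]\<^bsup>k\<^esup>"
      then obtain s where s: "s \<in> [B]\<^bsup>k\<^esup>" "y = c s" "c s \<in> A" by blast
      then have "s \<notin> [B - F]\<^bsup>k\<^esup>" using F(2) by (auto simp: f_def)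
      then obtain x where "x \<in> s" "x \<in> F" using s(1) by (auto simp: nsets_def)
      then show "y \<in> c ` (\<Union>x\<in>F. {a \<in> [UNIV]\<^bsup>k\<^esup>. c a \<in> A \<and> x \<in> a})"
        using s nsets_mono[of B UNIV k] by blast
    qed
    moreover have "finite (c ` (\<Union>x\<in>F. {a \<in> [UNIV]\<^bsup>k\<^esup>. c a \<in> A \<and> x \<in> a}))"
      using F(1) point_finite[OF A(1)] by blast
    ultimately show False using A(2) finite_subset by blast
  next
    case (2 y)
    obtain F where F: "finite F" "\<forall>s \<in> [B - F]\<^bsup>k\<^esup>. f s \<in> {Some (Inl y)}"
      using conv[OF openin_AU_compactum_isolated[OF 2(2)]] 2 by blast
    obtain x where x: "x \<in> B - F" using ex[OF F(1)] by blast
    obtain s where s: "s \<in> [B - F]\<^bsup>k\<^esup>"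
      using many[OF F(1) x] not_finite_existsD by blast
    have "{s \<in> [B - F]\<^bsup>k\<^esup>. x \<in> s} \<subseteq> {s}"
    proof
      fix t assume t: "t \<in> {s \<in> [B - F]\<^bsup>k\<^esup>. x \<in> s}"
      then have "c t = c s" using F(2) s by (auto simp: f_def)
      then show "t \<in> {s}" using c(1) t s nsets_mono[of "B - F" UNIV k] by (auto dest: inj_onD)
    qed
    then show False using many[OF F(1) x] finite_subset by blast
  next
    case (3 A)
    obtain F where F: "finite F" "\<forall>s \<in> [B - F]\<^bsup>k\<^esup>. f s \<in> Some ` insert (Inr A) (Inl ` A)"
      using conv[OF openin_AU_compactum_limit_point[OF ad 3(2)]] 3 by blast
    obtain x where x: "x \<in> B - F" using ex[OF F(1)] by blast
    have "{s \<in> [B - F]\<^bsup>k\<^esup>. x \<in> s} \<subseteq> {a \<in> [UNIV]\<^bsup>k\<^esup>. c a \<in> A \<and> x \<in> a}"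
      using F(2) nsets_mono[of "B - F" UNIV k] by (auto simp: f_def)
    then show False using many[OF F(1) x] point_finite[OF 3(2)] finite_subset by blast
  qed
qed

section \<open>The family on \<omega> obtained by coding (r+1)-sets\<close>

theorem theorem4p7:
  fixes r :: nat
  assumes "continuum_hypothesis" and "r > 1"
  shows "\<exists>\<A> :: nat set set. almost_disjoint_family UNIV \<A> \<and>
           Ramsey_space r (AU_compactum UNIV \<A>) \<and>
           \<not> Ramsey_space (r + 1) (AU_compactum UNIV \<A>)"
proof -
  let ?S = "[UNIV :: nat set]\<^bsup>Suc r\<^esup>"
  have "r > 0" using assms(2) by simp
  then show ?thesis
  proof (rule ex_separated_family[OF assms(1)])
    fix A :: "nat set \<Rightarrow> nat set set" assume A:
      "\<And>X. infinite X \<Longrightarrow> A X \<subseteq> [X]\<^bsup>Suc r\<^esup>"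
      "\<And>X. infinite X \<Longrightarrow> infinite (A X)"
      "\<And>X x. infinite X \<Longrightarrow> finite {a \<in> A X. x \<in> a}"
      "\<And>X Y. infinite X \<Longrightarrow> infinite Y \<Longrightarrow> X \<noteq> Y \<Longrightarrow> finite (A X \<inter> A Y)"
      "\<And>D. infinite D \<Longrightarrow> countable {X. infinite X \<and> infinite {a \<in> A X. \<not> separates D a}}"
    have AS: "A X \<subseteq> ?S" if "infinite X" for X
      using A(1)[OF that] nsets_mono[of X UNIV "Suc r"] by blast
    have "countable ?S" "infinite ?S"
      by (simp_all add: countable_nsets infinite_imp_infinite_nsets)
    \<comment> \<open>The family of sets of (r+1)-sets is carried to \<omega> by \<open>c\<close>;
      injectivity preserves infinite sets and intersections.\<close>
    then obtain c :: "nat set \<Rightarrow> nat" where c: "bij_betw c ?S UNIV"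
      using to_nat_on_infinite by blast
    then have inj: "inj_on c ?S" by (rule bij_betw_imp_inj_on)
    define \<A> where "\<A> = (\<lambda>X. c ` A X) ` {X. infinite X}"
    have ad: "almost_disjoint_family UNIV \<A>"
      unfolding almost_disjoint_family_def
    proof (intro conjI ballI impI)
      fix P assume "P \<in> \<A>"
      then obtain X where X: "infinite X" "P = c ` A X" by (auto simp: \<A>_def)
      then show "infinite P"
        using A(2) AS inj by (metis finite_imageD inj_on_subset)
      fix Q assume "Q \<in> \<A>" "P \<noteq> Q"
      then obtain Y where Y: "infinite Y" "Q = c ` A Y" "X \<noteq> Y" using X by (auto simp: \<A>_def)
      have "P \<inter> Q = c ` (A X \<inter> A Y)"
        using inj_on_image_Int[OF inj AS[OF X(1)] AS[OF Y(1)]] X Y by simp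
      then show "finite (P \<inter> Q)" using A(4) X Y by simp
    qed auto
    moreover have "Ramsey_space r (AU_compactum UNIV \<A>)"
    proof (rule Ramsey_space_AU_compactumI[OF ad])
      fix g :: "nat set \<Rightarrow> nat" and Z :: "nat set" assume Z: "infinite Z"
      \<comment> \<open>\<open>h\<close> decodes numbers as (r+1)-sets, so that separation applies
        to the values of \<open>g\<close>.\<close>
      define h where "h = inv_into ?S c"
      have h: "h (c a) = a" if "a \<in> ?S" for a using inv_into_f_f[OF inj that] by (simp add: h_def)
      have hS: "h n \<in> ?S" for n using c by (metis UNIV_I bij_betw_def h_def inv_into_into)
      obtain B D where B: "B \<subseteq> Z" "infinite B" "infinite D"
          "\<And>s. s \<in> [B]\<^bsup>r\<^esup> \<Longrightarrow> \<not> separates D (h (g s))"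
        using Ramsey_not_separates[OF Z, of r "h \<circ> g"] hS by (metis comp_apply)
      \<comment> \<open>Decoded values on \<open>B\<close> are never separated by \<open>D\<close>,
        so a member met infinitely often has an exceptional index.\<close>
      have "{P \<in> \<A>. infinite (P \<inter> g ` [B]\<^bsup>r\<^esup>)} \<subseteq>
          (\<lambda>X. c ` A X) ` {X. infinite X \<and> infinite {a \<in> A X. \<not> separates D a}}"
      proof
        fix P assume "P \<in> {P \<in> \<A>. infinite (P \<inter> g ` [B]\<^bsup>r\<^esup>)}"
        then obtain X where X: "infinite X" "P = c ` A X" "infinite (c ` A X \<inter> g ` [B]\<^bsup>r\<^esup>)"
          by (auto simp: \<A>_def)
        have "c ` A X \<inter> g ` [B]\<^bsup>r\<^esup> \<subseteq> c ` {a \<in> A X. \<not> separates D a}"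
        proof
          fix x assume "x \<in> c ` A X \<inter> g ` [B]\<^bsup>r\<^esup>"
          then obtain a s where a: "a \<in> A X" "x = c a" and s: "s \<in> [B]\<^bsup>r\<^esup>" "x = g s" by blast
          have "h (g s) = a" using h[of a] AS[OF X(1)] a s(2) by auto
          then have "\<not> separates D a" using B(4)[OF s(1)] by simp
          then show "x \<in> c ` {a \<in> A X. \<not> separates D a}" using a by blast
        qed
        then have "infinite {a \<in> A X. \<not> separates D a}"
          using X(3) finite_subset by blast
        then show "P \<in> (\<lambda>X. c ` A X) ` {X. infinite X \<and> infinite {a \<in> A X. \<not> separates D a}}"
          using X by blast
      qed
      then have "countable {P \<in> \<A>. infinite (P \<inter> g ` [B]\<^bsup>r\<^esup>)}"
        by (rule countable_subset) (rule countable_image[OF A(5)[OF B(3)]])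
      then show "\<exists>B \<subseteq> Z. infinite B \<and> countable {P \<in> \<A>. infinite (P \<inter> g ` [B]\<^bsup>r\<^esup>)}"
        using B by blast
    qed
    moreover have "\<not> Ramsey_space (Suc r) (AU_compactum UNIV \<A>)"
    proof (rule not_Ramsey_space_AU_compactum[OF ad inj])
      fix X :: "nat set" assume X: "infinite X"
      \<comment> \<open>The member indexed by \<open>X\<close> consists of codes of subsets of
        \<open>X\<close>, so it lies entirely in the range over \<open>X\<close>.\<close>
      have "c ` A X \<inter> c ` [X]\<^bsup>Suc r\<^esup> = c ` A X" using A(1)[OF X] by blast
      moreover have "infinite (c ` A X)"
        using A(2)[OF X] AS[OF X] inj by (metis finite_imageD inj_on_subset)
      ultimately show "\<exists>P\<in>\<A>. infinite (P \<inter> c ` [X]\<^bsup>Suc r\<^esup>)"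
        using X unfolding \<A>_def by (intro bexI[of _ "c ` A X"]) auto
    next
      fix P x assume "P \<in> \<A>"
      then obtain X where X: "infinite X" "P = c ` A X" by (auto simp: \<A>_def)
      have "{a \<in> ?S. c a \<in> P \<and> x \<in> a} \<subseteq> {a \<in> A X. x \<in> a}"
        using inj_on_image_mem_iff[OF inj _ AS[OF X(1)]] X(2) by blast
      then show "finite {a \<in> ?S. c a \<in> P \<and> x \<in> a}" using A(3)[OF X(1)] finite_subset by blast
    qed (use assms(2) in auto)
    ultimately show ?thesis by auto
  qed
qed

end
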